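(* Let $a>0$ and let $\varphi:[0,a]\to\mathbb{R}$ be a nonlinear, strictly increasing, concave, continuous function with $\varphi(0)=0$ and $\varphi(a)=1$. Then every measurable function $f:[0,a]\to\mathbb{C}$ such that $|f|=1$ a.e. on $[0,a]$ is an extreme point of the closed unit ball of the Lorentz space $\Lambda(\varphi)=\Lambda(\varphi)[0,a]$.
   Context: Let $m$ be Lebesgue measure on $[0,a]$. For a measurable $x:[0,a]\to\mathbb{C}$, the decreasing rearrangement of $|x|$ is $x^*(t):=\inf\{\tau\ge 0: m\{s\in[0,a]:|x(s)|>\tau\}\le t\}$, $0<t\le a$. The Lorentz space $\Lambda(\varphi)[0,a]$ consists of all (a.e.-equivalence classes of) measurable functions $x:[0,a]\to\mathbb{C}$ with $\|x\|_{\Lambda(\varphi)}:=\int_0^a x^*(t)\,d\varphi(t)<\infty$; it is a Banach space with this norm. "Nonlinear" means that $\varphi$ is not the function $t\mapsto t/a$. A point $x_0$ of the closed unit ball $\{x:\|x\|\le 1\}$ of a Banach space is extreme if it is not the midpoint of any nondegenerate segment contained in the ball. *)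

theory Defs
  imports "HOL-Analysis.Analysis"
begin

text \<open>
  Functions on \<open>[0,a]\<close> are total functions \<open>real \<Rightarrow> complex\<close> whose values outside \<open>{0..a}\<close> are
  never inspected. Elements of the Lorentz space are given by representatives, and equality of
  elements is equality almost everywhere with respect to \<open>lebesgue_on {0..a}\<close>.
\<close>

text \<open>
  For measurable \<open>x\<close> and \<open>t > 0\<close> the infimum is over a nonempty set, because \<open>{0..a}\<close> has finite
  measure; so the real-valued \<open>Inf\<close> is the true infimum. The value at \<open>t = 0\<close> is not used.
\<close>

definition decr_rearr :: "real \<Rightarrow> (real \<Rightarrow> complex) \<Rightarrow> real \<Rightarrow> real" where
  "decr_rearr a x t =
     Inf {\<tau>. 0 \<le> \<tau> \<and> measure (lebesgue_on {0..a}) {s \<in> {0..a}. cmod (x s) > \<tau>} \<le> t}"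

text \<open>
  The Lebesgue--Stieltjes measure \<open>d\<phi>\<close>: since \<^const>\<open>interval_measure\<close> expects a function on the
  whole line, \<open>\<phi>\<close> is extended by the constants \<open>\<phi> 0\<close> and \<open>\<phi> a\<close> outside \<open>{0..a}\<close>.
\<close>

definition stieltjes :: "real \<Rightarrow> (real \<Rightarrow> real) \<Rightarrow> real measure" where
  "stieltjes a \<phi> = interval_measure (\<lambda>t. \<phi> (max 0 (min a t)))"

definition lorentz_norm :: "real \<Rightarrow> (real \<Rightarrow> real) \<Rightarrow> (real \<Rightarrow> complex) \<Rightarrow> ennreal" where
  "lorentz_norm a \<phi> x = (\<integral>\<^sup>+t\<in>{0<..a}. ennreal (decr_rearr a x t) \<partial>stieltjes a \<phi>)"

definition lorentz_space :: "real \<Rightarrow> (real \<Rightarrow> real) \<Rightarrow> (real \<Rightarrow> complex) set" where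
  "lorentz_space a \<phi> = {x \<in> borel_measurable (lebesgue_on {0..a}). lorentz_norm a \<phi> x < \<infinity>}"

definition lorentz_ball :: "real \<Rightarrow> (real \<Rightarrow> real) \<Rightarrow> (real \<Rightarrow> complex) set" where
  "lorentz_ball a \<phi> = {x \<in> lorentz_space a \<phi>. lorentz_norm a \<phi> x \<le> 1}"

text \<open>
  The library's \<^const>\<open>extreme_point_of\<close> is not applicable, since it would distinguish functions
  that agree almost everywhere.
\<close>

definition lorentz_ball_extreme :: "real \<Rightarrow> (real \<Rightarrow> real) \<Rightarrow> (real \<Rightarrow> complex) \<Rightarrow> bool" where
  "lorentz_ball_extreme a \<phi> x0 \<longleftrightarrow>
     x0 \<in> lorentz_ball a \<phi> \<and>
     \<not> (\<exists>y z. \<not> (AE t in lebesgue_on {0..a}. y t = z t) \<and>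
              (\<forall>u\<in>{0..1}. (\<lambda>t. (1 - u) *\<^sub>R y t + u *\<^sub>R z t) \<in> lorentz_ball a \<phi>) \<and>
              (AE t in lebesgue_on {0..a}. x0 t = midpoint (y t) (z t)))"

end

theory Submission imports Defs begin

text \<open>
  By the layer cake formula, \<open>\<parallel>x\<parallel> = \<integral> \<phi>(m{|x| > \<tau>}) d\<tau>\<close> over \<open>\<tau> \<ge> 0\<close>. Concavity puts \<open>\<phi>\<close> above
  its chord \<open>t \<mapsto> t / a\<close>, so \<open>\<integral>|x| \<le> a \<parallel>x\<parallel>\<close>; as \<open>\<phi>\<close> is nonlinear, it lies strictly above the
  chord on \<open>(0,a)\<close>, so equality forces \<open>m{|x| > \<tau>} \<in> {0,a}\<close> for almost every \<open>\<tau>\<close>, i.e. \<open>|x|\<close> is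
  constant. If \<open>f\<close> is the midpoint of \<open>y\<close> and \<open>z\<close> in the unit ball, then \<open>|y| + |z| \<ge> 2\<close> while both
  integrals are at most \<open>a\<close>. Hence both equal \<open>a\<close>, so \<open>|y| = |z| = 1 = |(y + z) / 2|\<close>, and \<open>y = z\<close> by
  strict convexity of the disc.
\<close>

section \<open>Distribution functions\<close>

text \<open>The body copies the measure inside \<open>decr_rearr\<close> verbatim, so that unfolding
  \<open>decr_rearr_def\<close> can be followed by folding with
  \<open>distr_fun_def[symmetric]\<close>.\<close>

definition distr_fun :: "real \<Rightarrow> (real \<Rightarrow> complex) \<Rightarrow> real \<Rightarrow> real" where
  "distr_fun a x \<tau> = measure (lebesgue_on {0..a}) {s \<in> {0..a}. cmod (x s) > \<tau>}"

lemma finite_measure_lebesgue_on_Icc: "finite_measure (lebesgue_on {a..b::real})"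
  by (intro finite_measure_lebesgue_on) simp

lemma measurable_superlevel:
  assumes "x \<in> borel_measurable (lebesgue_on {0..a})"
  shows "{s \<in> {0..a}. cmod (x s) > \<tau>} \<in> sets (lebesgue_on {0..a})"
proof -
  note [measurable] = assms
  have "{s \<in> space (lebesgue_on {0..a}). cmod (x s) > \<tau>} \<in> sets (lebesgue_on {0..a})"
    by measurable
  then show ?thesis by simp
qed

lemma emeasure_superlevel:
  "emeasure (lebesgue_on {0..a}) {s \<in> {0..a}. cmod (x s) > \<tau>} = ennreal (distr_fun a x \<tau>)"
proof -
  interpret finite_measure "lebesgue_on {0..a}" by (rule finite_measure_lebesgue_on_Icc)
  show ?thesis by (simp add: distr_fun_def emeasure_eq_measure)
qed

lemma distr_fun_nonneg: "distr_fun a x \<tau> \<ge> 0"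
  by (simp add: distr_fun_def)

lemma distr_fun_le:
  assumes "a > 0"
  shows "distr_fun a x \<tau> \<le> a"
proof -
  interpret finite_measure "lebesgue_on {0..a}" by (rule finite_measure_lebesgue_on_Icc)
  have "distr_fun a x \<tau> \<le> measure (lebesgue_on {0..a}) (space (lebesgue_on {0..a}))"
    unfolding distr_fun_def by (rule bounded_measure)
  also have "\<dots> = a"
    using assms by (simp add: measure_restrict_space)
  finally show ?thesis .
qed

lemma distr_fun_antimono:
  assumes "x \<in> borel_measurable (lebesgue_on {0..a})"
  shows "antimono (distr_fun a x)"
proof
  interpret finite_measure "lebesgue_on {0..a}" by (rule finite_measure_lebesgue_on_Icc)
  fix \<sigma> \<tau> :: real assume "\<sigma> \<le> \<tau>"
  then show "distr_fun a x \<tau> \<le> distr_fun a x \<sigma>"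
    unfolding distr_fun_def
    by (intro finite_measure_mono measurable_superlevel assms) auto
qed

lemma borel_measurable_distr_fun:
  assumes "x \<in> borel_measurable (lebesgue_on {0..a})"
  shows "distr_fun a x \<in> borel_measurable borel"
proof -
  have "mono (\<lambda>t. - distr_fun a x t)"
    using distr_fun_antimono[OF assms] by (auto simp: mono_def antimono_def)
  then have "(\<lambda>t. - (- distr_fun a x t)) \<in> borel_measurable borel"
    by (intro borel_measurable_uminus borel_measurable_mono)
  then show ?thesis by simp
qed

text \<open>Continuity from above of a finite measure: the superlevel sets decrease to the empty set
  because \<open>cmod (x s)\<close> is finite at every point. This makes the infimum in
  \<open>decr_rearr\<close> range over a nonempty set when \<open>t > 0\<close>.\<close>

lemma distr_fun_tendsto_0:
  assumes "x \<in> borel_measurable (lebesgue_on {0..a})"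
  shows "(\<lambda>n. distr_fun a x (real n)) \<longlonglongrightarrow> 0"
proof -
  interpret finite_measure "lebesgue_on {0..a}" by (rule finite_measure_lebesgue_on_Icc)
  let ?A = "\<lambda>n. {s \<in> {0..a}. cmod (x s) > real n}"
  have "(\<lambda>n. measure (lebesgue_on {0..a}) (?A n)) \<longlonglongrightarrow> measure (lebesgue_on {0..a}) (\<Inter>n. ?A n)"
  proof (rule finite_Lim_measure_decseq)
    show "range ?A \<subseteq> sets (lebesgue_on {0..a})"
      using measurable_superlevel[OF assms] by blast
    show "decseq ?A" by (auto simp: decseq_def)
  qed
  also have "(\<Inter>n. ?A n) = {}"
  proof -
    have "\<exists>n. s \<notin> ?A n" for s
      using reals_Archimedean2[of "cmod (x s)"] by (auto simp: not_less intro: less_imp_le)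
    then show ?thesis by blast
  qed
  finally show ?thesis by (simp add: distr_fun_def)
qed

section \<open>Rearrangement and layer cake\<close>

text \<open>A level admissible in the infimum has distribution value at most \<open>t\<close>, hence
  below that of \<tau>, so by antitonicity it cannot lie below \<tau>. The condition
  \<open>0 < t\<close> excludes an infimum over the empty set.\<close>

lemma decr_rearr_ge:
  assumes x: "x \<in> borel_measurable (lebesgue_on {0..a})"
    and "0 < t" "t < distr_fun a x \<tau>"
  shows "\<tau> \<le> decr_rearr a x t"
  unfolding decr_rearr_def distr_fun_def[symmetric]
proof (rule cInf_greatest)
  have "\<forall>\<^sub>F n in sequentially. distr_fun a x (real n) < t"
    using distr_fun_tendsto_0[OF x] \<open>0 < t\<close> by (rule order_tendstoD)
  then obtain n where "distr_fun a x (real n) < t"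
    by (auto simp: eventually_sequentially)
  then have "real n \<in> {\<tau>. 0 \<le> \<tau> \<and> distr_fun a x \<tau> \<le> t}" by simp
  then show "{\<tau>. 0 \<le> \<tau> \<and> distr_fun a x \<tau> \<le> t} \<noteq> {}" by blast
next
  fix \<sigma> assume \<sigma>: "\<sigma> \<in> {\<tau>. 0 \<le> \<tau> \<and> distr_fun a x \<tau> \<le> t}"
  show "\<tau> \<le> \<sigma>"
  proof (rule ccontr)
    assume "\<not> \<tau> \<le> \<sigma>"
    then have "distr_fun a x \<tau> \<le> distr_fun a x \<sigma>"
      using distr_fun_antimono[OF x] by (auto simp: antimono_def)
    then show False using \<sigma> assms by auto
  qed
qed

lemma decr_rearr_le:
  assumes "0 \<le> \<tau>" "distr_fun a x \<tau> \<le> t"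
  shows "decr_rearr a x t \<le> \<tau>"
  unfolding decr_rearr_def distr_fun_def[symmetric]
  using assms by (intro cInf_lower) (auto intro!: bdd_belowI[of _ 0])

text \<open>Tonelli for the region \<open>0 \<le> \<tau> < cmod (x s)\<close>: its section at
  \<open>s\<close> has length \<open>cmod (x s)\<close>, its section at a level \<tau> \<ge> 0 has
  measure \<open>distr_fun a x \<tau>\<close>.\<close>

lemma nn_integral_cmod_layer_cake:
  assumes [measurable]: "x \<in> borel_measurable (lebesgue_on {0..a})"
  shows "(\<integral>\<^sup>+s. ennreal (cmod (x s)) \<partial>lebesgue_on {0..a}) =
    (\<integral>\<^sup>+\<tau>. ennreal (distr_fun a x \<tau>) * indicator {0..} \<tau> \<partial>lborel)"
proof -
  interpret finite_measure "lebesgue_on {0..a}" by (rule finite_measure_lebesgue_on_Icc)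
  interpret pair_sigma_finite "lebesgue_on {0..a}" lborel ..
  let ?f = "\<lambda>s \<tau>. if 0 \<le> \<tau> \<and> \<tau> < cmod (x s) then 1 else 0 :: ennreal"
  have "(\<integral>\<^sup>+\<tau>. ?f s \<tau> \<partial>lborel) = ennreal (cmod (x s))" for s
  proof -
    have "?f s \<tau> = indicator {0..<cmod (x s)} \<tau>" for \<tau> by (auto simp: indicator_def)
    then show ?thesis by simp
  qed
  then have "(\<integral>\<^sup>+s. ennreal (cmod (x s)) \<partial>lebesgue_on {0..a}) =
      (\<integral>\<^sup>+s. (\<integral>\<^sup>+\<tau>. ?f s \<tau> \<partial>lborel) \<partial>lebesgue_on {0..a})" by simp
  also have "\<dots> = (\<integral>\<^sup>+\<tau>. (\<integral>\<^sup>+s. ?f s \<tau> \<partial>lebesgue_on {0..a}) \<partial>lborel)"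
    by (rule Fubini'[symmetric]) measurable
  also have "\<dots> = (\<integral>\<^sup>+\<tau>. ennreal (distr_fun a x \<tau>) * indicator {0..} \<tau> \<partial>lborel)"
  proof (intro nn_integral_cong)
    fix \<tau> :: real
    have "(\<integral>\<^sup>+s. ?f s \<tau> \<partial>lebesgue_on {0..a}) =
      (\<integral>\<^sup>+s. indicator {0..} \<tau> * indicator {s \<in> {0..a}. cmod (x s) > \<tau>} s \<partial>lebesgue_on {0..a})"
      by (intro nn_integral_cong) (auto simp: indicator_def)
    also have "\<dots> = indicator {0..} \<tau> * ennreal (distr_fun a x \<tau>)"
      using measurable_superlevel[OF assms]
      by (simp only: nn_integral_cmult_indicator emeasure_superlevel)
    finally show "(\<integral>\<^sup>+s. ?f s \<tau> \<partial>lebesgue_on {0..a}) =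
        ennreal (distr_fun a x \<tau>) * indicator {0..} \<tau>" by (simp add: mult.commute)
  qed
  finally show ?thesis .
qed

section \<open>Concave functions and their chord\<close>

lemma concave_ge_chord:
  fixes \<phi> :: "real \<Rightarrow> real"
  assumes "concave_on {0..a} \<phi>" "\<phi> 0 = 0" "\<phi> a = 1" "s \<in> {0..a}"
  shows "s / a \<le> \<phi> s"
  using concave_onD_Icc'[of 0 a \<phi> s] assms by simp

text \<open>Suppose \<phi> touched the chord at the interior point \<open>s\<close>. For
  \<open>t\<close> on either side, \<open>s\<close> lies between \<open>t\<close> and the opposite
  endpoint of \<open>{0..a}\<close>; the chord of \<phi> over that subinterval lies below \<phi> at
  \<open>s\<close>, which bounds \<phi> at \<open>t\<close> by \<open>t / a\<close>. Then \<phi>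
  would be linear.\<close>

lemma concave_gt_chord:
  fixes \<phi> :: "real \<Rightarrow> real"
  assumes conc: "concave_on {0..a} \<phi>" and \<phi>0: "\<phi> 0 = 0" and \<phi>a: "\<phi> a = 1"
    and "\<exists>t\<in>{0..a}. \<phi> t \<noteq> t / a" and s: "0 < s" "s < a"
  shows "s / a < \<phi> s"
proof (rule ccontr)
  assume "\<not> s / a < \<phi> s"
  with concave_ge_chord[OF conc \<phi>0 \<phi>a, of s] s have eq: "\<phi> s = s / a" by auto
  have "\<phi> t = t / a" if t: "t \<in> {0..a}" for t
  proof -
    have "\<phi> t \<le> t / a"
    proof (cases "t \<le> s")
      case True
      have "concave_on {t..a} \<phi>"
        unfolding concave_on_def
        by (rule convex_on_subset[OF conc[unfolded concave_on_def]]) (use t in auto)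
      then have "(\<phi> t - \<phi> a) / (a - t) * (a - s) + \<phi> a \<le> \<phi> s"
        using True s by (intro concave_onD_Icc'') auto
      \<comment> \<open>Both sides thereby carry the positive factor \<open>a - s\<close>, which is
        cancelled below.\<close>
      moreover have "s / a - 1 = (a - s) * (- 1 / a)"
        using s by (simp add: field_simps)
      ultimately have "(a - s) * ((\<phi> t - 1) / (a - t)) \<le> (a - s) * (- 1 / a)"
        unfolding eq \<phi>a mult.commute[of "a - s"] by linarith
      then have "(\<phi> t - 1) / (a - t) \<le> - 1 / a"
        using s by (subst (asm) mult_le_cancel_left_pos) auto
      then show ?thesis using s True t by (simp add: field_simps)
    next
      case False
      have "concave_on {0..t} \<phi>"
        unfolding concave_on_def
        by (rule convex_on_subset[OF conc[unfolded concave_on_def]]) (use t in auto)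
      then have "(\<phi> t - \<phi> 0) / (t - 0) * (s - 0) + \<phi> 0 \<le> \<phi> s"
        using False s by (intro concave_onD_Icc') auto
      then show ?thesis using False s by (simp add: eq \<phi>0 field_simps)
    qed
    with concave_ge_chord[OF conc \<phi>0 \<phi>a t] show ?thesis by simp
  qed
  with assms(4) show False by auto
qed

section \<open>The Stieltjes measure and the Lorentz norm\<close>

locale lorentz_weight =
  fixes a :: real and \<phi> :: "real \<Rightarrow> real"
  assumes a_pos: "a > 0"
    and strict_mono: "strict_mono_on {0..a} \<phi>"
    and cont: "continuous_on {0..a} \<phi>"
    and \<phi>_0: "\<phi> 0 = 0"
    and \<phi>_a: "\<phi> a = 1"
begin

lemma extension_mono: "s \<le> t \<Longrightarrow> \<phi> (max 0 (min a s)) \<le> \<phi> (max 0 (min a t))"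
  using strict_mono_on_leD[OF strict_mono, of "max 0 (min a s)" "max 0 (min a t)"] a_pos
  by (auto simp: max_def min_def)

lemma extension_continuous: "continuous_on UNIV (\<lambda>t. \<phi> (max 0 (min a t)))"
  using a_pos by (intro continuous_on_compose2[OF cont] continuous_intros) auto

lemma extension_continuous_at_right: "continuous (at_right s) (\<lambda>t. \<phi> (max 0 (min a t)))"
  using extension_continuous
  by (auto simp: continuous_on_eq_continuous_within intro: continuous_within_subset)

lemma sets_stieltjes [measurable_cong]: "sets (stieltjes a \<phi>) = sets borel"
  by (simp add: stieltjes_def)

lemma sigma_finite_stieltjes: "sigma_finite_measure (stieltjes a \<phi>)"
  unfolding stieltjes_def
  by (intro sigma_finite_interval_measure extension_mono extension_continuous_at_right)

lemma emeasure_stieltjes_Ioc: "s \<in> {0..a} \<Longrightarrow> emeasure (stieltjes a \<phi>) {0<..s} = ennreal (\<phi> s)"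
  unfolding stieltjes_def
  by (subst emeasure_interval_measure_Ioc)
    (use extension_mono extension_continuous_at_right a_pos \<phi>_0 in auto)

text \<open>Continuity of \<phi> leaves the measure without atoms, so the right endpoint carries no
  mass. Open intervals arise as the sections \<open>0 < t < distr_fun a x \<tau>\<close> in the
  lower bound for the norm.\<close>

lemma emeasure_stieltjes_Ioo:
  assumes "s \<in> {0..a}"
  shows "emeasure (stieltjes a \<phi>) {0<..<s} = ennreal (\<phi> s)"
proof -
  have "emeasure (stieltjes a \<phi>) {s..s} = 0"
    unfolding stieltjes_def
    by (subst emeasure_interval_measure_Icc) (use extension_mono extension_continuous in auto)
  then have "{s} \<in> null_sets (stieltjes a \<phi>)"
    by (auto simp: null_sets_def sets_stieltjes)
  then have "emeasure (stieltjes a \<phi>) ({0<..s} - {s}) = emeasure (stieltjes a \<phi>) {0<..s}"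
    by (intro emeasure_Diff_null_set) (auto simp: sets_stieltjes)
  also have "{0<..s} - {s} = {0<..<s}" by auto
  finally show ?thesis using emeasure_stieltjes_Ioc[OF assms] by simp
qed

lemma \<phi>_distr_fun_measurable:
  assumes "x \<in> borel_measurable (lebesgue_on {0..a})"
  shows "(\<lambda>\<tau>. \<phi> (distr_fun a x \<tau>)) \<in> borel_measurable borel"
proof -
  \<comment> \<open>Outside \<open>{0..a}\<close> nothing is known of \<phi>. The clamped extension
    is continuous on the whole line and agrees with \<phi> at the values of
    \<open>distr_fun\<close>, which lie in \<open>{0..a}\<close>.\<close>
  have "(\<lambda>\<tau>. \<phi> (max 0 (min a (distr_fun a x \<tau>)))) \<in> borel_measurable borel"
    using borel_measurable_distr_fun[OF assms]
    by (rule measurable_compose) (intro borel_measurable_continuous_onI extension_continuous)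
  then show ?thesis
    by (simp add: min_absorb2 max_absorb2 distr_fun_le[OF a_pos] distr_fun_nonneg)
qed

text \<open>Tonelli for the region \<open>0 < t < distr_fun a x \<tau>\<close> with \<tau> \<ge> 0:
  by \<open>decr_rearr_ge\<close> its section at \<open>t\<close> lies inside
  \<open>{0..decr_rearr a x t}\<close>. This is one half of the layer cake formula for the norm, the
  half that turns a bound on the norm into a bound on the level integral.\<close>

lemma lorentz_norm_ge_layer_cake:
  assumes x: "x \<in> borel_measurable (lebesgue_on {0..a})"
  shows "(\<integral>\<^sup>+\<tau>. ennreal (\<phi> (distr_fun a x \<tau>)) * indicator {0..} \<tau> \<partial>lborel) \<le> lorentz_norm a \<phi> x"
proof -
  interpret sigma_finite_measure "stieltjes a \<phi>" by (rule sigma_finite_stieltjes)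
  interpret pair_sigma_finite "stieltjes a \<phi>" lborel ..
  note [measurable] = borel_measurable_distr_fun[OF x]
  let ?f = "\<lambda>t \<tau>. if 0 \<le> \<tau> \<and> 0 < t \<and> t < distr_fun a x \<tau> then 1 else 0 :: ennreal"
  have "(\<integral>\<^sup>+\<tau>. ennreal (\<phi> (distr_fun a x \<tau>)) * indicator {0..} \<tau> \<partial>lborel) =
      (\<integral>\<^sup>+\<tau>. (\<integral>\<^sup>+t. ?f t \<tau> \<partial>stieltjes a \<phi>) \<partial>lborel)"
  proof (intro nn_integral_cong)
    fix \<tau> :: real
    have "(\<integral>\<^sup>+t. ?f t \<tau> \<partial>stieltjes a \<phi>) =
      (\<integral>\<^sup>+t. indicator {0..} \<tau> * indicator {0<..<distr_fun a x \<tau>} t \<partial>stieltjes a \<phi>)"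
      by (intro nn_integral_cong) (auto simp: indicator_def)
    also have "\<dots> = indicator {0..} \<tau> * ennreal (\<phi> (distr_fun a x \<tau>))"
      by (simp add: nn_integral_cmult sets_stieltjes emeasure_stieltjes_Ioo
          distr_fun_nonneg distr_fun_le[OF a_pos])
    finally show "ennreal (\<phi> (distr_fun a x \<tau>)) * indicator {0..} \<tau> =
        (\<integral>\<^sup>+t. ?f t \<tau> \<partial>stieltjes a \<phi>)" by (simp add: mult.commute)
  qed
  also have "\<dots> = (\<integral>\<^sup>+t. (\<integral>\<^sup>+\<tau>. ?f t \<tau> \<partial>lborel) \<partial>stieltjes a \<phi>)"
    by (rule Fubini') measurable
  also have "\<dots> \<le> (\<integral>\<^sup>+t. ennreal (decr_rearr a x t) * indicator {0<..a} t \<partial>stieltjes a \<phi>)"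
  proof (intro nn_integral_mono)
    fix t
    show "(\<integral>\<^sup>+\<tau>. ?f t \<tau> \<partial>lborel) \<le> ennreal (decr_rearr a x t) * indicator {0<..a} t"
    proof (cases "t \<in> {0<..a}")
      case True
      have "(\<integral>\<^sup>+\<tau>. ?f t \<tau> \<partial>lborel) \<le> (\<integral>\<^sup>+\<tau>. indicator {0..decr_rearr a x t} \<tau> \<partial>lborel)"
        by (intro nn_integral_mono) (auto simp: indicator_def dest: decr_rearr_ge[OF x])
      \<comment> \<open>In the negative case the interval is empty and both sides vanish.\<close>
      also have "\<dots> \<le> ennreal (decr_rearr a x t)"
        by (cases "0 \<le> decr_rearr a x t") auto
      finally show ?thesis using True by simp
    next
      case False
      then have "?f t \<tau> = 0" for \<tau>
        using distr_fun_le[OF a_pos, of x \<tau>] by auto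
      then show ?thesis by simp
    qed
  qed
  finally show ?thesis by (simp add: lorentz_norm_def)
qed

text \<open>The rearrangement is at most 1 since \<open>{|x| > 1}\<close> is null, and the Stieltjes
  measure of \<open>{0<..a}\<close> is 1. This puts \<open>f\<close> itself into the ball.\<close>

lemma lorentz_norm_le_1:
  assumes x: "x \<in> borel_measurable (lebesgue_on {0..a})"
    and "AE t in lebesgue_on {0..a}. cmod (x t) \<le> 1"
  shows "lorentz_norm a \<phi> x \<le> 1"
proof -
  have "emeasure (lebesgue_on {0..a}) {s \<in> {0..a}. cmod (x s) > 1} = 0"
    using assms(2) by (subst (asm) AE_iff_measurable) (use measurable_superlevel[OF x] in \<open>auto simp: not_le\<close>)
  then have "distr_fun a x 1 = 0"
    by (simp add: distr_fun_def measure_def)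
  then have "lorentz_norm a \<phi> x \<le> (\<integral>\<^sup>+t. indicator {0<..a} t \<partial>stieltjes a \<phi>)"
    unfolding lorentz_norm_def
    by (intro nn_integral_mono) (auto simp: indicator_def intro!: decr_rearr_le)
  also have "\<dots> = 1"
    using emeasure_stieltjes_Ioc[of a] a_pos \<phi>_a by (simp add: sets_stieltjes)
  finally show ?thesis .
qed

end

section \<open>Comparison with the integral of the modulus\<close>

locale concave_lorentz_weight = lorentz_weight +
  assumes concave: "concave_on {0..a} \<phi>"
begin

lemma chord_le_\<phi>_distr_fun: "distr_fun a x \<tau> / a \<le> \<phi> (distr_fun a x \<tau>)"
  using concave_ge_chord[OF concave \<phi>_0 \<phi>_a] distr_fun_nonneg distr_fun_le[OF a_pos] by simp

lemma nn_integral_chord: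
  assumes x: "x \<in> borel_measurable (lebesgue_on {0..a})"
  shows "(\<integral>\<^sup>+\<tau>. ennreal (distr_fun a x \<tau> / a) * indicator {0..} \<tau> \<partial>lborel) =
    ennreal (1 / a) * (\<integral>\<^sup>+s. ennreal (cmod (x s)) \<partial>lebesgue_on {0..a})"
proof -
  note [measurable] = borel_measurable_distr_fun[OF x]
  have "ennreal (distr_fun a x \<tau> / a) = ennreal (1 / a) * ennreal (distr_fun a x \<tau>)" for \<tau>
    using a_pos by (simp add: ennreal_mult'[symmetric] distr_fun_nonneg)
  then show ?thesis
    by (simp add: nn_integral_cmult mult.assoc nn_integral_cmod_layer_cake[OF x])
qed

text \<open>The chord inequality, integrated over all levels, bounds the mean of \<open>|x|\<close>
  by the Lorentz norm.\<close>

lemma nn_integral_cmod_le: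
  assumes x: "x \<in> lorentz_ball a \<phi>"
  shows "(\<integral>\<^sup>+s. ennreal (cmod (x s)) \<partial>lebesgue_on {0..a}) \<le> ennreal a"
proof -
  have m: "x \<in> borel_measurable (lebesgue_on {0..a})" and n: "lorentz_norm a \<phi> x \<le> 1"
    using x by (auto simp: lorentz_ball_def lorentz_space_def)
  let ?I = "\<integral>\<^sup>+s. ennreal (cmod (x s)) \<partial>lebesgue_on {0..a}"
  have "ennreal (1 / a) * ?I \<le>
      (\<integral>\<^sup>+\<tau>. ennreal (\<phi> (distr_fun a x \<tau>)) * indicator {0..} \<tau> \<partial>lborel)"
    unfolding nn_integral_chord[OF m, symmetric]
    by (intro nn_integral_mono mult_right_mono ennreal_leI chord_le_\<phi>_distr_fun) auto
  also have "\<dots> \<le> 1"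
    using lorentz_norm_ge_layer_cake[OF m] n by (rule order_trans)
  finally have "ennreal a * (ennreal (1 / a) * ?I) \<le> ennreal a * 1"
    by (intro mult_left_mono) auto
  then show ?thesis
    using a_pos by (simp add: mult.assoc[symmetric] ennreal_mult'[symmetric])
qed

text \<open>Equality in \<open>nn_integral_cmod_le\<close> forces equality in the chord inequality
  at almost every level, so \<open>distr_fun\<close> takes only the values 0 and \<open>a\<close>
  there. Above level 1 the value \<open>a\<close> would make the integral too large, which leaves
  0.\<close>

lemma cmod_le_1_AE:
  assumes nonlinear: "\<exists>t\<in>{0..a}. \<phi> t \<noteq> t / a"
    and x: "x \<in> lorentz_ball a \<phi>"
    and I: "(\<integral>\<^sup>+s. ennreal (cmod (x s)) \<partial>lebesgue_on {0..a}) = ennreal a"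
  shows "AE s in lebesgue_on {0..a}. cmod (x s) \<le> 1"
proof -
  have m: "x \<in> borel_measurable (lebesgue_on {0..a})" and n: "lorentz_norm a \<phi> x \<le> 1"
    using x by (auto simp: lorentz_ball_def lorentz_space_def)
  note [measurable] = m borel_measurable_distr_fun[OF m] \<phi>_distr_fun_measurable[OF m]
  let ?\<phi> = "\<lambda>\<tau>. ennreal (\<phi> (distr_fun a x \<tau>)) * indicator {0..} \<tau>"
  let ?l = "\<lambda>\<tau>. ennreal (distr_fun a x \<tau> / a) * indicator {0..} \<tau>"
  have l1: "(\<integral>\<^sup>+\<tau>. ?l \<tau> \<partial>lborel) = 1"
    unfolding nn_integral_chord[OF m] I using a_pos by (simp add: ennreal_mult'[symmetric])
  \<comment> \<open>The integral of \<open>?l\<close> is 1, hence finite as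
    \<open>nn_integral_diff\<close> demands. That of the larger function is at most 1, so the
    truncated difference in \<open>ennreal\<close> is 0.\<close>
  have "(\<integral>\<^sup>+\<tau>. ?\<phi> \<tau> - ?l \<tau> \<partial>lborel) = (\<integral>\<^sup>+\<tau>. ?\<phi> \<tau> \<partial>lborel) - (\<integral>\<^sup>+\<tau>. ?l \<tau> \<partial>lborel)"
    using l1
    by (intro nn_integral_diff)
      (auto intro!: AE_I2 mult_right_mono ennreal_leI chord_le_\<phi>_distr_fun)
  also have "\<dots> = 0"
    unfolding l1 using lorentz_norm_ge_layer_cake[OF m] n
    by (intro diff_eq_0_ennreal) (auto intro: order_trans le_less_trans)
  finally have "AE \<tau> in lborel. ?\<phi> \<tau> - ?l \<tau> = 0"
    by (subst (asm) nn_integral_0_iff_AE) auto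
  then have two_values: "AE \<tau> in lborel. \<tau> \<ge> 0 \<longrightarrow> distr_fun a x \<tau> = 0 \<or> distr_fun a x \<tau> = a"
  proof (eventually_elim, intro impI)
    fix \<tau> :: real assume "?\<phi> \<tau> - ?l \<tau> = 0" "\<tau> \<ge> 0"
    then have "ennreal (\<phi> (distr_fun a x \<tau>)) \<le> ennreal (distr_fun a x \<tau> / a)"
      by (simp add: diff_eq_0_iff_ennreal)
    then have "\<phi> (distr_fun a x \<tau>) \<le> distr_fun a x \<tau> / a"
      using a_pos by (subst (asm) ennreal_le_iff) (auto simp: distr_fun_nonneg)
    then show "distr_fun a x \<tau> = 0 \<or> distr_fun a x \<tau> = a"
      using concave_gt_chord[OF concave \<phi>_0 \<phi>_a nonlinear, of "distr_fun a x \<tau>"]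
        distr_fun_nonneg[of a x \<tau>] distr_fun_le[OF a_pos, of x \<tau>] by linarith
  qed
  have not_a: "distr_fun a x \<tau> \<noteq> a" if "\<tau> > 1" for \<tau>
  proof
    assume eq: "distr_fun a x \<tau> = a"
    \<comment> \<open>Markov's inequality at level \<tau>, for a superlevel set of full
      measure.\<close>
    have "ennreal (\<tau> * a) = ennreal \<tau> * emeasure (lebesgue_on {0..a}) {s \<in> {0..a}. cmod (x s) > \<tau>}"
      unfolding emeasure_superlevel using that by (simp add: eq ennreal_mult')
    also have "\<dots> = (\<integral>\<^sup>+s. ennreal \<tau> * indicator {s \<in> {0..a}. cmod (x s) > \<tau>} s \<partial>lebesgue_on {0..a})"
      using measurable_superlevel[OF m] by (simp add: nn_integral_cmult)
    also have "\<dots> \<le> (\<integral>\<^sup>+s. ennreal (cmod (x s)) \<partial>lebesgue_on {0..a})"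
      by (intro nn_integral_mono) (auto simp: indicator_def intro!: ennreal_leI)
    finally have "\<tau> * a \<le> a"
      using a_pos unfolding I by simp
    then show False using that a_pos by simp
  qed
  have zero: "distr_fun a x \<tau> = 0" if "\<tau> > 1" for \<tau>
  proof -
    \<comment> \<open>\<open>two_values\<close> may fail at \<tau> itself, but not on all of an
      interval of positive length. A good level \<sigma> below \<tau> suffices by
      antitonicity.\<close>
    have "\<exists>\<sigma>\<in>{1<..<\<tau>}. distr_fun a x \<sigma> = 0"
    proof (rule ccontr)
      assume *: "\<not> (\<exists>\<sigma>\<in>{1<..<\<tau>}. distr_fun a x \<sigma> = 0)"
      have "AE \<sigma> in lborel. \<sigma> \<notin> {1<..<\<tau>}"
        using two_values by eventually_elim (use * not_a in auto)
      then have "emeasure lborel {1<..<\<tau>} = 0"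
        by (subst (asm) AE_iff_measurable) auto
      then show False using that by simp
    qed
    then obtain \<sigma> where "\<sigma> < \<tau>" "distr_fun a x \<sigma> = 0" by auto
    then have "distr_fun a x \<tau> \<le> 0"
      using distr_fun_antimono[OF m] by (metis antimonoD less_imp_le)
    then show ?thesis using distr_fun_nonneg[of a x \<tau>] by simp
  qed
  \<comment> \<open>\<open>zero\<close> covers only levels strictly above 1; level 1 is reached as a
    countable limit.\<close>
  have "AE s in lebesgue_on {0..a}. cmod (x s) \<le> 1 + 1 / real (Suc n)" for n
  proof -
    have "emeasure (lebesgue_on {0..a}) {s \<in> {0..a}. cmod (x s) > 1 + 1 / real (Suc n)} = 0"
      unfolding emeasure_superlevel by (subst zero) auto
    then show ?thesis
      by (subst AE_iff_measurable[OF measurable_superlevel[OF m]]) (auto simp: not_le)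
  qed
  then have "AE s in lebesgue_on {0..a}. \<forall>n. cmod (x s) \<le> 1 + 1 / real (Suc n)"
    by (simp only: AE_all_countable) simp
  then show ?thesis
  proof eventually_elim
    case (elim s)
    show ?case
    proof (rule LIMSEQ_le_const)
      show "(\<lambda>n. 1 + 1 / real (Suc n)) \<longlonglongrightarrow> 1"
        using tendsto_add[OF tendsto_const LIMSEQ_Suc[OF lim_1_over_n], of "1::real"] by simp
      show "\<exists>N. \<forall>n\<ge>N. cmod (x s) \<le> 1 + 1 / real (Suc n)" using elim by blast
    qed
  qed
qed

end

section \<open>Strict convexity and extremality\<close>

text \<open>By the parallelogram law, \<open>norm (y + z) = 2\<close> already exhausts the bound 4
  on the sum of the two squares, leaving 0 for \<open>y - z\<close>.\<close>

lemma midpoint_unit_imp_eq: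
  fixes y z :: "'a::real_inner"
  assumes "norm y \<le> 1" "norm z \<le> 1" "norm (midpoint y z) = 1"
  shows "y = z"
proof -
  have "norm (y + z) = 2"
    using assms(3) by (simp add: midpoint_def)
  moreover have "(norm (y + z))\<^sup>2 + (norm (y - z))\<^sup>2 = 2 * (norm y)\<^sup>2 + 2 * (norm z)\<^sup>2"
    by (simp add: power2_norm_eq_inner inner_simps inner_commute)
  ultimately have "4 + (norm (y - z))\<^sup>2 = 2 * (norm y)\<^sup>2 + 2 * (norm z)\<^sup>2" by simp
  moreover have "(norm y)\<^sup>2 \<le> 1" "(norm z)\<^sup>2 \<le> 1"
    using assms by (simp_all add: power_le_one)
  ultimately have "(norm (y - z))\<^sup>2 \<le> 0" by linarith
  then show ?thesis by simp
qed

theorem theorem10: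
  fixes a :: real and \<phi> :: "real \<Rightarrow> real" and f :: "real \<Rightarrow> complex"
  assumes "a > 0"
    and "strict_mono_on {0..a} \<phi>"
    and "concave_on {0..a} \<phi>"
    and "continuous_on {0..a} \<phi>"
    and "\<phi> 0 = 0"
    and "\<phi> a = 1"
    and "\<exists>t\<in>{0..a}. \<phi> t \<noteq> t / a"
    and "f \<in> borel_measurable (lebesgue_on {0..a})"
    and "AE t in lebesgue_on {0..a}. cmod (f t) = 1"
  shows "lorentz_ball_extreme a \<phi> f"
proof -
  interpret concave_lorentz_weight a \<phi>
    using assms by unfold_locales auto
  have "AE t in lebesgue_on {0..a}. cmod (f t) \<le> 1"
    using assms(9) by eventually_elim simp
  then have norm_f: "lorentz_norm a \<phi> f \<le> 1"
    by (rule lorentz_norm_le_1[OF assms(8)])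
  then have "f \<in> lorentz_ball a \<phi>"
    using assms(8) by (auto simp: lorentz_ball_def lorentz_space_def intro: le_less_trans)
  moreover have "AE t in lebesgue_on {0..a}. y t = z t"
    if seg: "\<forall>u\<in>{0..1}. (\<lambda>t. (1 - u) *\<^sub>R y t + u *\<^sub>R z t) \<in> lorentz_ball a \<phi>"
      and mid: "AE t in lebesgue_on {0..a}. f t = midpoint (y t) (z t)" for y z
  proof -
    have y: "y \<in> lorentz_ball a \<phi>" and z: "z \<in> lorentz_ball a \<phi>"
      using seg[rule_format, of 0] seg[rule_format, of 1] by simp_all
    then have [measurable]: "y \<in> borel_measurable (lebesgue_on {0..a})"
        "z \<in> borel_measurable (lebesgue_on {0..a})"
      by (auto simp: lorentz_ball_def lorentz_space_def)
    let ?I = "\<lambda>x. \<integral>\<^sup>+s. ennreal (cmod (x s)) \<partial>lebesgue_on {0..a}"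
    have "ennreal (2 * a) = (\<integral>\<^sup>+s. 2 \<partial>lebesgue_on {0..a})"
      using a_pos by (simp add: emeasure_restrict_space ennreal_mult')
    also have "\<dots> \<le> (\<integral>\<^sup>+s. ennreal (cmod (y s)) + ennreal (cmod (z s)) \<partial>lebesgue_on {0..a})"
    proof (rule nn_integral_mono_AE)
      show "AE s in lebesgue_on {0..a}. 2 \<le> ennreal (cmod (y s)) + ennreal (cmod (z s))"
        using mid assms(9)
      proof eventually_elim
        case (elim s)
        then have "cmod (y s + z s) = 2" by (simp add: midpoint_def)
        then have "2 \<le> cmod (y s) + cmod (z s)"
          using norm_triangle_ineq[of "y s" "z s"] by simp
        then have "ennreal 2 \<le> ennreal (cmod (y s) + cmod (z s))" by (rule ennreal_leI)
        then show ?case by (simp add: ennreal_plus)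
      qed
    qed
    also have "\<dots> = ?I y + ?I z" by (rule nn_integral_add) measurable
    finally have sum: "ennreal (2 * a) \<le> ?I y + ?I z" .
    have bound: "?I y \<le> ennreal a" "?I z \<le> ennreal a"
      using nn_integral_cmod_le y z by auto
    \<comment> \<open>Finiteness lets the squeeze run in the reals: two numbers at most
      \<open>a\<close> with sum at least \<open>2 * a\<close> both equal \<open>a\<close>.\<close>
    then obtain p q where pq: "?I y = ennreal p" "?I z = ennreal q" "p \<ge> 0" "q \<ge> 0"
      by (metis ennreal_cases ennreal_neq_top neq_top_trans)
    then have "p \<le> a" "q \<le> a" "2 * a \<le> p + q"
      using bound sum a_pos by (simp_all add: ennreal_plus[symmetric] del: ennreal_plus)
    then have "p = a" "q = a" by auto
    with pq have "?I y = ennreal a" "?I z = ennreal a" by auto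
    then have "AE s in lebesgue_on {0..a}. cmod (y s) \<le> 1" "AE s in lebesgue_on {0..a}. cmod (z s) \<le> 1"
      using cmod_le_1_AE[OF assms(7)] y z by auto
    with mid assms(9) show ?thesis
      by eventually_elim (auto intro: midpoint_unit_imp_eq)
  qed
  ultimately show ?thesis
    unfolding lorentz_ball_extreme_def by blast
qed

end
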